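(* Let $n\ge2$ and equip $\mathcal{G}^s_{n-2}$ with its standard labeling. For $\omega\in\Omega(\mathcal{G}^s_{n-2})$ let $\ell_1,\dots,\ell_{n-1}$ be the multiplicities of the vertical edges of $\mathcal{G}^s_{n-2}$ read from right to left, and let $\varphi(\omega)\in S_n$ be the permutation whose Lehmer code $(L_1,\dots,L_n)$ is given by $L_i=\sum_{j=1}^{i}(-1)^{j+1}\ell_j-\lfloor i/2\rfloor$ for $1\le i\le n-1$ and $L_n=0$. Then: (a) $\varphi$ is a poset isomorphism from $\Omega(\mathcal{G}^s_{n-2})$ with the face twist order onto the set $\mathrm{Alt}_n$ of alternating permutations with the restriction of the left middle order. (b) $\displaystyle E_n(q):=\sum_{\sigma\in\mathrm{Alt}_n}q^{\mathrm{inv}(\sigma)} = q^{\lfloor n/2\rfloor}\,\Omega(\mathcal{G}^s_{n-2},q)$.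
   Context: Mixed dimer covers: for a finite graph $\mathcal{G}=(V,E)$ and $\mathbf{n}\colon V\to\mathbb{N}$, a mixed dimer cover is $\omega\colon E\to\mathbb{N}$ with $\sum_{e\ni v}\omega(e)=\mathbf{n}(v)$ for all $v$. $\mathcal{G}^s_N$ is the $2\times(N+1)$ grid graph with vertices $v_{r,k}$ ($r=1$ bottom, $r=2$ top, $0\le k\le N$), vertical edges $v_{1,k}v_{2,k}$, horizontal edges $v_{r,k-1}v_{r,k}$. Its standard labeling gives both $v_{1,k},v_{2,k}$ the value $k+1$; $\Omega(\mathcal{G}^s_N)$ is the set of mixed dimer covers for this labeling. Face twist order: properly 2-color the vertices black/white so that the bottom-right vertex $v_{1,N}$ is black. Traversing the boundary of a square face counterclockwise, an edge traversed from black to white is even and one traversed from white to black is odd. If all odd edges of a face have positive multiplicity in $\omega$, decreasing each odd edge by $1$ and increasing each even edge by $1$ is a positive face twist; the face twist order is the partial order on $\Omega(\mathcal{G}^s_N)$ generated by $\omega<\omega'$ whenever $\omega'$ is obtained from $\omega$ by a positive face twist. $\mathrm{rk}(\omega)$ is the minimal number of face twists needed to reach $\omega$ from the minimal element, and $\Omega(\mathcal{G}^s_N,q)=\sum_\omega q^{\mathrm{rk}(\omega)}$. The Lehmer code of $\sigma\in S_n$ is $(L_1,\dots,L_n)$ with $L_i=\#\{j>i:\sigma(j)<\sigma(i)\}$; the left middle order on $S_n$ is $\sigma\le\tau$ iff $L_i(\sigma)\le L_i(\tau)$ for all $i$. $\sigma\in S_n$ is alternating if $\sigma(1)>\sigma(2)<\sigma(3)>\cdots$;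 $\mathrm{inv}(\sigma)$ is the number of inversions. *)

theory Defs
  imports "HOL-Combinatorics.Permutations"
begin

(* Edges are two-element vertex sets.  A function E -> nat is represented by its
   extension by 0 to all sets, so that covers are equal iff they agree on E. *)
definition mixed_dimer_covers ::
  "'v set \<Rightarrow> 'v set set \<Rightarrow> ('v \<Rightarrow> nat) \<Rightarrow> ('v set \<Rightarrow> nat) set" where
  "mixed_dimer_covers V E label =
     {w. (\<forall>e. e \<notin> E \<longrightarrow> w e = 0) \<and> (\<forall>v\<in>V. (\<Sum>e\<in>{e \<in> E. v \<in> e}. w e) = label v)}"

(* The pair (r, k) is the vertex in row r (1 = bottom, 2 = top) and column k,
   columns being numbered from left to right. *)
type_synonym vertex = "nat \<times> nat"
type_synonym cover = "vertex set \<Rightarrow> nat"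

definition grid_verts :: "nat \<Rightarrow> vertex set" where
  "grid_verts N = {1, 2} \<times> {0..N}"

definition vert_edge :: "nat \<Rightarrow> vertex set" where
  "vert_edge k = {(1, k), (2, k)}"

definition horiz_edge :: "nat \<Rightarrow> nat \<Rightarrow> vertex set" where
  "horiz_edge r k = {(r, k - 1), (r, k)}"

definition grid_edges :: "nat \<Rightarrow> vertex set set" where
  "grid_edges N = vert_edge ` {0..N} \<union> {horiz_edge r k | r k. r \<in> {1, 2} \<and> k \<in> {1..N}}"

definition standard_label :: "vertex \<Rightarrow> nat" where
  "standard_label v = snd v + 1"

definition grid_covers :: "nat \<Rightarrow> cover set" where
  "grid_covers N = mixed_dimer_covers (grid_verts N) (grid_edges N) standard_label"

(* The proper 2-colouring in which the bottom-right vertex (1, N) is black. *)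
definition black :: "nat \<Rightarrow> vertex \<Rightarrow> bool" where
  "black N v \<longleftrightarrow> (fst v + snd v) mod 2 = (1 + N) mod 2"

(* The counterclockwise oriented boundary of the square between columns k - 1 and k. *)
definition face_boundary :: "nat \<Rightarrow> (vertex \<times> vertex) set" where
  "face_boundary k =
     {((1, k - 1), (1, k)), ((1, k), (2, k)), ((2, k), (2, k - 1)), ((2, k - 1), (1, k - 1))}"

definition even_edges :: "nat \<Rightarrow> nat \<Rightarrow> vertex set set" where
  "even_edges N k = {{u, v} | u v. (u, v) \<in> face_boundary k \<and> black N u \<and> \<not> black N v}"

definition odd_edges :: "nat \<Rightarrow> nat \<Rightarrow> vertex set set" where
  "odd_edges N k = {{u, v} | u v. (u, v) \<in> face_boundary k \<and> \<not> black N u \<and> black N v}"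

definition twist_at :: "nat \<Rightarrow> nat \<Rightarrow> cover \<Rightarrow> cover" where
  "twist_at N k w =
     (\<lambda>e. if e \<in> odd_edges N k then w e - 1 else if e \<in> even_edges N k then w e + 1 else w e)"

definition positive_twist :: "nat \<Rightarrow> (cover \<times> cover) set" where
  "positive_twist N =
     {(w, w'). w \<in> grid_covers N \<and> w' \<in> grid_covers N \<and>
        (\<exists>k\<in>{1..N}. (\<forall>e\<in>odd_edges N k. w e > 0) \<and> w' = twist_at N k w)}"

definition twist_order :: "nat \<Rightarrow> (cover \<times> cover) set" where
  "twist_order N = (positive_twist N)\<^sup>* \<inter> grid_covers N \<times> grid_covers N"

definition minimal_cover :: "nat \<Rightarrow> cover" where
  "minimal_cover N =
     (THE w. w \<in> grid_covers N \<and> (\<forall>w'\<in>grid_covers N. (w', w) \<in> twist_order N \<longrightarrow> w' = w))"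

definition cover_rank :: "nat \<Rightarrow> cover \<Rightarrow> nat" where
  "cover_rank N w = (LEAST m. (minimal_cover N, w) \<in> positive_twist N ^^ m)"

(* Taking q to be the indeterminate of a polynomial ring gives the formal polynomial. *)
definition cover_gf :: "nat \<Rightarrow> 'a::comm_semiring_1 \<Rightarrow> 'a" where
  "cover_gf N q = (\<Sum>w\<in>grid_covers N. q ^ cover_rank N w)"

definition symgroup :: "nat \<Rightarrow> (nat \<Rightarrow> nat) set" where
  "symgroup n = {\<sigma>. \<sigma> permutes {1..n}}"

definition lehmer :: "nat \<Rightarrow> (nat \<Rightarrow> nat) \<Rightarrow> nat \<Rightarrow> nat" where
  "lehmer n \<sigma> i = card {j. i < j \<and> j \<le> n \<and> \<sigma> j < \<sigma> i}"

definition left_middle_order :: "nat \<Rightarrow> ((nat \<Rightarrow> nat) \<times> (nat \<Rightarrow> nat)) set" where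
  "left_middle_order n =
     {(\<sigma>, \<tau>). \<sigma> \<in> symgroup n \<and> \<tau> \<in> symgroup n \<and> (\<forall>i\<in>{1..n}. lehmer n \<sigma> i \<le> lehmer n \<tau> i)}"

definition alternating_perms :: "nat \<Rightarrow> (nat \<Rightarrow> nat) set" where
  "alternating_perms n =
     {\<sigma> \<in> symgroup n. \<forall>i. 1 \<le> i \<and> i < n \<longrightarrow>
        (if odd i then \<sigma> i > \<sigma> (i + 1) else \<sigma> i < \<sigma> (i + 1))}"

definition inv_count :: "nat \<Rightarrow> (nat \<Rightarrow> nat) \<Rightarrow> nat" where
  "inv_count n \<sigma> = card {(i, j). 1 \<le> i \<and> i < j \<and> j \<le> n \<and> \<sigma> j < \<sigma> i}"

definition alternating_gf :: "nat \<Rightarrow> 'a::comm_semiring_1 \<Rightarrow> 'a" where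
  "alternating_gf n q = (\<Sum>\<sigma>\<in>alternating_perms n. q ^ inv_count n \<sigma>)"

(* Columns are 0, ..., n - 2, so the j-th vertical edge from the right is in column n - 1 - j. *)
definition vert_mult :: "nat \<Rightarrow> cover \<Rightarrow> nat \<Rightarrow> nat" where
  "vert_mult n w j = w (vert_edge (n - 1 - j))"

definition cover_code :: "nat \<Rightarrow> cover \<Rightarrow> nat \<Rightarrow> int" where
  "cover_code n w i =
     (if i = n then 0
      else (\<Sum>j=1..i. (-1) ^ (j + 1) * int (vert_mult n w j)) - int (i div 2))"

definition phi :: "nat \<Rightarrow> cover \<Rightarrow> nat \<Rightarrow> nat" where
  "phi n w = (THE \<sigma>. \<sigma> \<in> symgroup n \<and> (\<forall>i\<in>{1..n}. int (lehmer n \<sigma> i) = cover_code n w i))"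

definition poset_isomorphism ::
  "'a set \<Rightarrow> ('a \<times> 'a) set \<Rightarrow> 'b set \<Rightarrow> ('b \<times> 'b) set \<Rightarrow> ('a \<Rightarrow> 'b) \<Rightarrow> bool" where
  "poset_isomorphism A r B s f \<longleftrightarrow>
     partial_order_on A r \<and> partial_order_on B s \<and> bij_betw f A B \<and>
     (\<forall>x\<in>A. \<forall>y\<in>A. (x, y) \<in> r \<longleftrightarrow> (f x, f y) \<in> s)"

end

theory Submission imports Defs begin

text \<open>The vertex conditions force the two horizontal edges of each face to have the same
  multiplicity, say \<open>h\<^sub>k\<close> for the face between columns \<open>k - 1\<close> and \<open>k\<close>, and covers correspond to
  the sequences with \<open>h\<^sub>k + h\<^sub>k\<^sub>+\<^sub>1 \<le> k + 1\<close> and zeros at both ends. In these terms \<open>L\<^sub>i\<close> is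
  \<open>h\<^sub>k\<close> or \<open>n - i - h\<^sub>k\<close> with \<open>k = n - 1 - i\<close>, for even and odd \<open>i\<close> respectively, and the
  inequalities become exactly \<open>L\<^sub>i > L\<^sub>i\<^sub>+\<^sub>1\<close> for odd and \<open>L\<^sub>i \<le> L\<^sub>i\<^sub>+\<^sub>1\<close> for even \<open>i\<close>, that is,
  the condition that a permutation with this Lehmer code is alternating. A positive twist of face
  \<open>k\<close> raises \<open>L\<^sub>i\<close> by one and fixes the other entries. Comparable codes are linked by such unit
  steps, so the twist order is the componentwise order of codes, and the rank of a cover is its
  code sum minus that of the least code \<open>(1, 0, 1, 0, \<dots>)\<close>.\<close>

section \<open>Lehmer codes\<close>

text \<open>Passing to a larger element of \<open>S\<close> adds the smaller one to the counted set.
  The count is the rank within \<open>S\<close> and so identifies the element.\<close>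

lemma card_less_inj:
  fixes a b :: nat
  assumes "finite S" "a \<in> S" "b \<in> S" "card {x \<in> S. x < a} = card {x \<in> S. x < b}"
  shows "a = b"
proof (rule ccontr)
  have *: "card {x \<in> S. x < a} < card {x \<in> S. x < b}" if "a < b" "a \<in> S" for a b
    using that assms(1) by (intro psubset_card_mono) auto
  assume "a \<noteq> b"
  then show False
    using *[of a b] *[of b a] assms by linarith
qed

lemma inj_symgroup: "\<sigma> \<in> symgroup n \<Longrightarrow> inj \<sigma>"
  by (auto simp: symgroup_def intro: permutes_inj)

lemma lehmer_eq_card_remaining:
  assumes "\<sigma> \<in> symgroup n" "i \<in> {1..n}"
  shows "lehmer n \<sigma> i = card {x \<in> {1..n} - \<sigma> ` {1..<i}. x < \<sigma> i}"
proof -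
  have perm: "\<sigma> permutes {1..n}"
    using assms(1) by (simp add: symgroup_def)
  have inj: "inj \<sigma>"
    using assms(1) by (rule inj_symgroup)
  have "{x \<in> {1..n} - \<sigma> ` {1..<i}. x < \<sigma> i} = \<sigma> ` {j. i < j \<and> j \<le> n \<and> \<sigma> j < \<sigma> i}"
  proof (intro set_eqI iffI)
    fix x assume x: "x \<in> {x \<in> {1..n} - \<sigma> ` {1..<i}. x < \<sigma> i}"
    then obtain j where j: "j \<in> {1..n}" "x = \<sigma> j"
      using permutes_image[OF perm] by blast
    with x have "j \<notin> {1..<i}" "j \<noteq> i"
      by auto
    with x j show "x \<in> \<sigma> ` {j. i < j \<and> j \<le> n \<and> \<sigma> j < \<sigma> i}"
      by auto
  next
    fix x assume "x \<in> \<sigma> ` {j. i < j \<and> j \<le> n \<and> \<sigma> j < \<sigma> i}"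
    then obtain j where j: "i < j" "j \<le> n" "\<sigma> j < \<sigma> i" "x = \<sigma> j"
      by auto
    then have "\<sigma> j \<in> {1..n}"
      using permutes_in_image[OF perm, of j] assms(2) by auto
    with j show "x \<in> {x \<in> {1..n} - \<sigma> ` {1..<i}. x < \<sigma> i}"
      by (auto simp: inj_eq[OF inj])
  qed
  then show ?thesis
    by (simp add: lehmer_def card_image inj_on_subset[OF inj])
qed

text \<open>Strong induction on the position: if all earlier values agree, the same values remain
  available, and the rank among them fixes the next one.\<close>

lemma lehmer_inj:
  assumes \<sigma>: "\<sigma> \<in> symgroup n" and \<tau>: "\<tau> \<in> symgroup n"
    and eq: "\<And>i. i \<in> {1..n} \<Longrightarrow> lehmer n \<sigma> i = lehmer n \<tau> i"
  shows "\<sigma> = \<tau>"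
proof
  fix i
  have perm: "\<sigma> permutes {1..n}" "\<tau> permutes {1..n}"
    using \<sigma> \<tau> by (simp_all add: symgroup_def)
  show "\<sigma> i = \<tau> i"
  proof (cases "i \<in> {1..n}")
    case True
    then show ?thesis
    proof (induction i rule: less_induct)
      case (less i)
      define S where "S = {1..n} - \<sigma> ` {1..<i}"
      have *: "\<rho> i \<in> {1..n} - \<rho> ` {1..<i}" if "\<rho> permutes {1..n}" for \<rho>
        using permutes_in_image[OF that, of i] less.prems
        by (auto simp: inj_eq[OF permutes_inj[OF that]])
      have "\<sigma> ` {1..<i} = \<tau> ` {1..<i}"
        using less.IH less.prems by (intro image_cong refl) simp
      then have S': "S = {1..n} - \<tau> ` {1..<i}"
        by (simp add: S_def)
      have "card {x \<in> S. x < \<sigma> i} = card {x \<in> S. x < \<tau> i}"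
        using eq[OF less.prems]
        unfolding lehmer_eq_card_remaining[OF \<sigma> less.prems, folded S_def]
          lehmer_eq_card_remaining[OF \<tau> less.prems, folded S'] .
      moreover have "\<sigma> i \<in> S" "\<tau> i \<in> S"
        using *[OF perm(1)] *[OF perm(2)] S_def S' by blast+
      moreover have "finite S"
        by (simp add: S_def)
      ultimately show ?case
        using card_less_inj[of S "\<sigma> i" "\<tau> i"] by blast
    qed
  next
    case False
    then show ?thesis
      using permutes_not_in[OF perm(1)] permutes_not_in[OF perm(2)] by simp
  qed
qed

lemma lehmer_le: "lehmer n \<sigma> i \<le> n - i"
proof -
  have "card {j. i < j \<and> j \<le> n \<and> \<sigma> j < \<sigma> i} \<le> card {i<..n}"
    by (intro card_mono) auto
  then show ?thesis
    by (simp add: lehmer_def)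
qed

text \<open>Counting replaces an explicit decoding. Codes embed the n! permutations into a product
  of ranges of sizes n, ..., 1, which also has n! elements, so every bounded sequence is attained.
  Unique existence gives the \<open>THE\<close> in \<open>phi\<close> its meaning.\<close>

lemma ex1_lehmer:
  assumes c: "\<And>i. i \<in> {1..n} \<Longrightarrow> c i \<le> n - i"
  shows "\<exists>!\<sigma>. \<sigma> \<in> symgroup n \<and> (\<forall>i\<in>{1..n}. lehmer n \<sigma> i = c i)"
proof -
  \<comment> \<open>Restriction to \<open>{1..n}\<close> places the codes in the extensional product
    \<open>C\<close>, which is finite.\<close>
  define F where "F = (\<lambda>\<sigma>. restrict (lehmer n \<sigma>) {1..n})"
  define C where "C = (\<Pi>\<^sub>E i\<in>{1..n}. {..n - i})"
  have F_eq: "F \<sigma> = restrict c {1..n} \<longleftrightarrow> (\<forall>i\<in>{1..n}. lehmer n \<sigma> i = c i)" for \<sigma> c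
    by (auto simp: F_def restrict_def fun_eq_iff)
  have inj: "inj_on F (symgroup n)"
  proof (rule inj_onI)
    fix \<sigma> \<tau> assume "\<sigma> \<in> symgroup n" "\<tau> \<in> symgroup n" "F \<sigma> = F \<tau>"
    then show "\<sigma> = \<tau>"
      using F_eq[of \<sigma> "lehmer n \<tau>"] by (intro lehmer_inj[of _ n]) (auto simp: F_def)
  qed
  have "card C = (\<Prod>i\<in>{1..n}. n - i + 1)"
    unfolding C_def by (subst card_PiE) auto
  also have "\<dots> = \<Prod>{1..n}"
    by (rule prod.reindex_bij_witness[of _ "\<lambda>i. n + 1 - i" "\<lambda>i. n + 1 - i"]) auto
  also have "\<dots> = card (F ` symgroup n)"
    using card_permutations[of "{1..n}" n] inj
    by (simp add: card_image symgroup_def fact_prod)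
  finally have "card C = card (F ` symgroup n)" .
  moreover have "F ` symgroup n \<subseteq> C"
    using lehmer_le by (auto simp: F_def C_def)
  moreover have "finite C"
    by (auto simp: C_def intro: finite_PiE)
  ultimately have "F ` symgroup n = C"
    by (intro card_subset_eq) auto
  moreover have "restrict c {1..n} \<in> C"
    using c by (auto simp: C_def)
  ultimately obtain \<sigma> where "\<sigma> \<in> symgroup n" "F \<sigma> = restrict c {1..n}"
    by (metis imageE)
  then have \<sigma>: "\<sigma> \<in> symgroup n" "\<forall>i\<in>{1..n}. lehmer n \<sigma> i = c i"
    unfolding F_eq by blast+
  show ?thesis
  proof (rule ex1I)
    show "\<sigma> \<in> symgroup n \<and> (\<forall>i\<in>{1..n}. lehmer n \<sigma> i = c i)"
      using \<sigma> by blast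
    fix \<tau> assume "\<tau> \<in> symgroup n \<and> (\<forall>i\<in>{1..n}. lehmer n \<tau> i = c i)"
    then show "\<tau> = \<sigma>"
      using \<sigma> lehmer_inj[of \<tau> n \<sigma>] by metis
  qed
qed

text \<open>At a descent, everything counted at \<open>i + 1\<close> is also counted at
  \<open>i\<close>, together with \<open>i + 1\<close> itself. At an ascent, \<open>i + 1\<close> is
  not counted at \<open>i\<close> and the inclusion is reversed.\<close>

lemma lehmer_descent_iff:
  assumes "\<sigma> \<in> symgroup n" "1 \<le> i" "i < n"
  shows "\<sigma> (i + 1) < \<sigma> i \<longleftrightarrow> lehmer n \<sigma> (i + 1) < lehmer n \<sigma> i"
proof -
  define A where "A = (\<lambda>i. {j. i < j \<and> j \<le> n \<and> \<sigma> j < \<sigma> i})"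
  have fin: "finite (A i)" for i
    by (rule finite_subset[of _ "{..n}"]) (auto simp: A_def)
  have L: "lehmer n \<sigma> i = card (A i)" for i
    by (simp add: lehmer_def A_def)
  have "\<sigma> i \<noteq> \<sigma> (i + 1)"
    using inj_eq[OF inj_symgroup[OF assms(1)]] by simp
  then consider "\<sigma> (i + 1) < \<sigma> i" | "\<sigma> i < \<sigma> (i + 1)"
    by linarith
  then show ?thesis
  proof cases
    case 1
    have "i + 1 \<in> A i" "i + 1 \<notin> A (i + 1)"
      using 1 assms(3) by (auto simp: A_def)
    moreover have "A (i + 1) \<subseteq> A i"
      using 1 by (auto simp: A_def)
    ultimately have "card (A (i + 1)) < card (A i)"
      by (intro psubset_card_mono fin) auto
    with 1 L show ?thesis by simp
  next
    case 2
    have "A i \<subseteq> A (i + 1)"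
    proof
      fix j assume "j \<in> A i"
      moreover from this 2 have "j \<noteq> i + 1" by (auto simp: A_def)
      ultimately show "j \<in> A (i + 1)" using 2 by (auto simp: A_def)
    qed
    then have "card (A i) \<le> card (A (i + 1))"
      by (intro card_mono fin)
    with 2 L show ?thesis by simp
  qed
qed

lemma inv_count_eq_sum_lehmer: "inv_count n \<sigma> = (\<Sum>i\<in>{1..n}. lehmer n \<sigma> i)"
proof -
  have "{(i, j). 1 \<le> i \<and> i < j \<and> j \<le> n \<and> \<sigma> j < \<sigma> i}
      = (SIGMA i:{1..n}. {j. i < j \<and> j \<le> n \<and> \<sigma> j < \<sigma> i})"
    by auto
  then show ?thesis
    by (simp add: inv_count_def lehmer_def card_SigmaI)
qed

section \<open>Codes of alternating permutations\<close>

definition alternating_codes :: "nat \<Rightarrow> (nat \<Rightarrow> int) set" where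
  "alternating_codes n =
     {c. (\<forall>i\<in>{1..n}. 0 \<le> c i \<and> c i \<le> int (n - i)) \<and>
         (\<forall>i. 1 \<le> i \<and> i < n \<longrightarrow> (if odd i then c i > c (i + 1) else c i \<le> c (i + 1)))}"

text \<open>Descents are strict drops of the code. By injectivity an ascent is the failure of a
  descent, hence the weak inequality at even positions.\<close>

lemma alternating_perms_iff_code:
  "\<sigma> \<in> alternating_perms n \<longleftrightarrow>
     \<sigma> \<in> symgroup n \<and> (\<lambda>i. int (lehmer n \<sigma> i)) \<in> alternating_codes n"
proof (cases "\<sigma> \<in> symgroup n")
  case True
  have le: "int (lehmer n \<sigma> i) \<le> int (n - i)" for i
    by (simp only: of_nat_le_iff lehmer_le)
  have "\<sigma> i \<noteq> \<sigma> (i + 1)" for i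
    using inj_eq[OF inj_symgroup[OF True]] by simp
  then have ascent: "\<sigma> i < \<sigma> (i + 1) \<longleftrightarrow> \<not> \<sigma> (i + 1) < \<sigma> i" for i
    by (meson linorder_neqE_nat less_asym)
  have "(if odd i then \<sigma> i > \<sigma> (i + 1) else \<sigma> i < \<sigma> (i + 1)) \<longleftrightarrow>
      (if odd i then int (lehmer n \<sigma> i) > int (lehmer n \<sigma> (i + 1))
       else int (lehmer n \<sigma> i) \<le> int (lehmer n \<sigma> (i + 1)))" if "1 \<le> i \<and> i < n" for i
    using lehmer_descent_iff[OF True, of i] that unfolding ascent of_nat_le_iff of_nat_less_iff
    by (simp only: not_less)
  with True le show ?thesis
    unfolding alternating_perms_def alternating_codes_def
    by (simp only: mem_Collect_eq of_nat_0_le_iff ball_triv simp_thms cong: imp_cong)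
qed (simp add: alternating_perms_def)

text \<open>Entries outside \<open>{1..n}\<close> are unconstrained. This matters because
  \<open>cover_code\<close> and the Lehmer code of \<open>phi\<close> are related only on that
  range.\<close>

lemma alternating_codes_transfer:
  assumes "c \<in> alternating_codes n" "\<And>i. i \<in> {1..n} \<Longrightarrow> d i = c i"
  shows "d \<in> alternating_codes n"
proof -
  have "d i = c i \<and> d (i + 1) = c (i + 1)" if "1 \<le> i \<and> i < n" for i
    using that assms(2)[of i] assms(2)[of "i + 1"] by simp
  with assms show ?thesis
    unfolding alternating_codes_def by (simp only: mem_Collect_eq simp_thms ball_triv cong: imp_cong ball_cong) blast
qed

section \<open>Covers of the ladder graph\<close>

text \<open>Truncated subtraction makes \<open>horiz_edge r 0\<close> a singleton, but the largest
  column in the set is still the index, so injectivity includes this degenerate case.\<close>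

lemma horiz_edge_eq_iff [simp]: "horiz_edge r k = horiz_edge s l \<longleftrightarrow> r = s \<and> k = l"
  unfolding horiz_edge_def doubleton_eq_iff by auto

lemma vert_edge_eq_iff [simp]: "vert_edge k = vert_edge l \<longleftrightarrow> k = l"
  unfolding vert_edge_def doubleton_eq_iff by auto

lemma vert_edge_neq_horiz_edge [simp]:
  "vert_edge k \<noteq> horiz_edge r l" "horiz_edge r l \<noteq> vert_edge k"
  unfolding horiz_edge_def vert_edge_def doubleton_eq_iff by auto

lemma horiz_edge_mem_grid_edges:
  "horiz_edge r k \<in> grid_edges N \<longleftrightarrow> r \<in> {1, 2} \<and> k \<in> {1..N}"
  unfolding grid_edges_def by auto

lemma vert_edge_mem_grid_edges: "vert_edge k \<in> grid_edges N \<longleftrightarrow> k \<le> N"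
  unfolding grid_edges_def by auto

lemma grid_edges_cases:
  assumes "e \<in> grid_edges N"
  obtains (vert) k where "k \<le> N" "e = vert_edge k"
    | (horiz) r k where "r \<in> {1, 2}" "k \<in> {1..N}" "e = horiz_edge r k"
  using assms unfolding grid_edges_def image_iff Un_iff mem_Collect_eq
  by (metis atLeastAtMost_iff)

text \<open>Since \<^term>\<open>horiz_edge r 0\<close> and \<^term>\<open>horiz_edge r (N + 1)\<close> are not edges, a cover
  vanishes there, and the condition at the corners needs no special treatment.\<close>

lemma grid_covers_iff:
  "w \<in> grid_covers N \<longleftrightarrow>
     (\<forall>e. e \<notin> grid_edges N \<longrightarrow> w e = 0) \<and>
     (\<forall>r\<in>{1, 2}. \<forall>k\<le>N. w (vert_edge k) + w (horiz_edge r k) + w (horiz_edge r (k + 1)) = k + 1)"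
proof (cases "\<forall>e. e \<notin> grid_edges N \<longrightarrow> w e = 0")
  case True
  have "(\<Sum>e\<in>{e \<in> grid_edges N. (r, k) \<in> e}. w e)
      = w (vert_edge k) + w (horiz_edge r k) + w (horiz_edge r (k + 1))"
    if "r \<in> {1, 2}" for r k
  proof -
    have "(\<Sum>e\<in>{e \<in> grid_edges N. (r, k) \<in> e}. w e)
        = (\<Sum>e\<in>{vert_edge k, horiz_edge r k, horiz_edge r (k + 1)}. w e)"
    proof (rule sum.mono_neutral_left)
      show "{e \<in> grid_edges N. (r, k) \<in> e} \<subseteq> {vert_edge k, horiz_edge r k, horiz_edge r (k + 1)}"
      proof
        fix e assume "e \<in> {e \<in> grid_edges N. (r, k) \<in> e}"
        then have e: "e \<in> grid_edges N" "(r, k) \<in> e" by auto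
        from e(1) show "e \<in> {vert_edge k, horiz_edge r k, horiz_edge r (k + 1)}"
        proof (cases rule: grid_edges_cases)
          case (vert l)
          with e(2) have "k = l" by (auto simp: vert_edge_def)
          with vert show ?thesis by simp
        next
          case (horiz s l)
          with e(2) have "r = s" "k = l \<or> l = k + 1" by (auto simp: horiz_edge_def)
          with horiz show ?thesis by auto
        qed
      qed
      have "(r, k) \<in> e" if "e \<in> {vert_edge k, horiz_edge r k, horiz_edge r (k + 1)}" for e
        using that \<open>r \<in> {1, 2}\<close> by (auto simp: vert_edge_def horiz_edge_def)
      then show "\<forall>e\<in>{vert_edge k, horiz_edge r k, horiz_edge r (k + 1)}
          - {e \<in> grid_edges N. (r, k) \<in> e}. w e = 0"
        using True by (metis (mono_tags, lifting) DiffE mem_Collect_eq)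
    qed simp
    then show ?thesis by simp
  qed
  then show ?thesis
    using True
    by (auto simp: grid_covers_def mixed_dimer_covers_def grid_verts_def standard_label_def)
qed (unfold grid_covers_def mixed_dimer_covers_def, blast)

text \<open>The coordinate \<open>h\<^sub>k\<close> of a cover, read in the bottom row; by
  \<open>cover_horiz_edge\<close> the top row gives the same value.\<close>

definition rail :: "cover \<Rightarrow> nat \<Rightarrow> nat" where
  "rail w k = w (horiz_edge 1 k)"

lemma rail_outside [simp]:
  assumes "w \<in> grid_covers N"
  shows "rail w 0 = 0" "N < k \<Longrightarrow> rail w k = 0"
  using assms by (auto simp: grid_covers_iff rail_def horiz_edge_mem_grid_edges)

lemma cover_vert_edge:
  assumes "w \<in> grid_covers N" "k \<le> N"
  shows "w (vert_edge k) + rail w k + rail w (k + 1) = k + 1"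
  using assms by (auto simp: grid_covers_iff rail_def)

text \<open>Induction over the columns from the left: the two vertices of a column have the same
  label and share the vertical edge, so agreement of the rows passes from the left horizontal edges
  to the right ones.\<close>

lemma cover_horiz_edge:
  assumes w: "w \<in> grid_covers N" and "r \<in> {1, 2}"
  shows "w (horiz_edge r k) = rail w k"
proof -
  have "w (horiz_edge 2 k) = w (horiz_edge 1 k)"
  proof (induction k)
    case 0
    show ?case using w by (auto simp: grid_covers_iff horiz_edge_mem_grid_edges)
  next
    case (Suc k)
    show ?case
    proof (cases "k \<le> N")
      case True
      have "w (vert_edge k) + w (horiz_edge r k) + w (horiz_edge r (Suc k)) = k + 1"
        if "r \<in> {1, 2}" for r
        using w True that by (auto simp: grid_covers_iff)
      from this[of 1] this[of 2] Suc show ?thesis by simp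
    next
      case False
      then show ?thesis using w by (auto simp: grid_covers_iff horiz_edge_mem_grid_edges)
    qed
  qed
  with assms(2) show ?thesis by (auto simp: rail_def)
qed

text \<open>The vertex equations express the vertical multiplicities through the rails, which are
  therefore coordinates for covers.\<close>

lemma cover_eqI:
  assumes w: "w \<in> grid_covers N" and w': "w' \<in> grid_covers N"
    and eq: "\<And>k. k \<in> {1..N} \<Longrightarrow> rail w k = rail w' k"
  shows "w = w'"
proof
  fix e
  have rail: "rail w k = rail w' k" for k
    using eq[of k] w w' by (cases "k \<in> {1..N}") (auto simp: not_le)
  show "w e = w' e"
  proof (cases "e \<in> grid_edges N")
    case True
    then show ?thesis
    proof (cases rule: grid_edges_cases)
      case (vert k)
      then show ?thesis using cover_vert_edge[OF w, of k] cover_vert_edge[OF w', of k] rail by simp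
    next
      case (horiz r k)
      then show ?thesis using cover_horiz_edge[OF w] cover_horiz_edge[OF w'] rail by simp
    qed
  next
    case False
    then show ?thesis using w w' by (simp add: grid_covers_iff)
  qed
qed

text \<open>Both horizontal edges of face \<open>k\<close> receive \<open>h k\<close>, and each
  vertical edge receives what its endpoints still lack. The inequality on \<open>h\<close> makes the
  truncated subtraction exact.\<close>

lemma ex_cover_rail:
  assumes "h 0 = 0" "h (N + 1) = 0" and h: "\<And>k. k \<le> N \<Longrightarrow> h k + h (k + 1) \<le> k + 1"
  obtains w where "w \<in> grid_covers N" "\<And>k. k \<le> N + 1 \<Longrightarrow> rail w k = h k"
proof -
  \<comment> \<open>Edges are bare vertex sets, so their indices are recovered by
    \<open>THE\<close>; injectivity of \<open>vert_edge\<close> and \<open>horiz_edge\<close> makes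
    these descriptions unambiguous.\<close>
  define w :: cover where "w = (\<lambda>e. if e \<notin> grid_edges N then 0
    else if e \<in> range vert_edge then THE m. \<exists>k. e = vert_edge k \<and> m = k + 1 - h k - h (k + 1)
    else THE m. \<exists>r k. e = horiz_edge r k \<and> m = h k)"
  have vert: "w (vert_edge k) = k + 1 - h k - h (k + 1)" if "k \<le> N" for k
    using that by (simp add: w_def vert_edge_mem_grid_edges)
  have horiz: "w (horiz_edge r k) = h k" if "r \<in> {1, 2}" "k \<le> N + 1" for r k
  proof (cases "k \<in> {1..N}")
    case True
    have "horiz_edge r k \<notin> range vert_edge" by auto
    with True that show ?thesis by (simp add: w_def horiz_edge_mem_grid_edges)
  next
    case False
    then have "k = 0 \<or> k = N + 1" using that by auto
    with False assms show ?thesis by (auto simp: w_def horiz_edge_mem_grid_edges)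
  qed
  show thesis
  proof
    show "w \<in> grid_covers N"
      unfolding grid_covers_iff
    proof (intro conjI allI ballI impI)
      fix r :: nat and k assume "r \<in> {1, 2}" "k \<le> N"
      then show "w (vert_edge k) + w (horiz_edge r k) + w (horiz_edge r (k + 1)) = k + 1"
        using vert[of k] horiz[of r k] horiz[of r "k + 1"] h[of k] by simp
    qed (simp add: w_def)
    show "rail w k = h k" if "k \<le> N + 1" for k
      using horiz[of 1 k] that by (simp add: rail_def)
  qed
qed

section \<open>The code of a cover\<close>

text \<open>Each vertical multiplicity is its label minus the two adjacent rails. In the alternating
  sum the inner rails cancel and the rail at \<open>N + 1\<close> is zero, so one rail survives. The
  alternating sum of the labels leaves a constant from which \<open>i div 2\<close> is
  removed.\<close>

lemma cover_code_eq_rail: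
  assumes w: "w \<in> grid_covers N" and "1 \<le> i" "i \<le> N + 1"
  shows "cover_code (N + 2) w i =
    (if even i then int (rail w (N + 1 - i)) else int (N + 2 - i) - int (rail w (N + 1 - i)))"
  using assms(2,3)
proof (induction i rule: dec_induct)
  case base
  have "vert_mult (N + 2) w 1 + rail w N = N + 1"
    using cover_vert_edge[OF w, of N] w by (simp add: vert_mult_def)
  then show ?case by (simp add: cover_code_def)
next
  case (step i)
  define k where "k = N - i"
  have k: "N + 1 - i = k + 1" "N + 1 - Suc i = k" "N + 2 - i = k + 2" "N + 2 - Suc i = k + 1" "i = N - k" "k \<le> N"
    using step by (auto simp: k_def)
  have "vert_mult (N + 2) w (Suc i) + rail w k + rail w (k + 1) = k + 1"
    using cover_vert_edge[OF w, of k] step by (simp add: vert_mult_def k_def)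
  \<comment> \<open>The term \<open>i div 2\<close> grows exactly when \<open>i\<close> is odd.
    Since \<open>Suc i\<close> is at most \<open>N + 1\<close>, the exceptional clause for the last
    entry does not apply.\<close>
  moreover have "cover_code (N + 2) w (Suc i) = cover_code (N + 2) w i
      + (if even i then 1 else -1) * int (vert_mult (N + 2) w (Suc i)) - of_bool (odd i)"
    using step by (auto simp: cover_code_def elim!: evenE oddE)
  ultimately show ?case
    using step unfolding k by (auto split: if_splits)
qed

lemma cover_code_last [simp]: "cover_code n w n = 0"
  by (simp add: cover_code_def)

text \<open>With \<open>k = N - i\<close>, consecutive entries are
  \<open>h\<^sub>k\<^sub>+\<^sub>1\<close> and \<open>k + 1 - h\<^sub>k\<close> for even
  \<open>i\<close>, and \<open>k + 2 - h\<^sub>k\<^sub>+\<^sub>1\<close> and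
  \<open>h\<^sub>k\<close> for odd \<open>i\<close>. Both comparisons are the bound on the sum of
  adjacent rails; the additional 1 makes the odd one strict.\<close>

lemma cover_code_mem:
  assumes w: "w \<in> grid_covers N"
  shows "cover_code (N + 2) w \<in> alternating_codes (N + 2)"
  unfolding alternating_codes_def mem_Collect_eq
proof (intro conjI ballI allI impI)
  fix i assume i: "i \<in> {1..N + 2}"
  have "0 \<le> cover_code (N + 2) w i \<and> cover_code (N + 2) w i \<le> int (N + 2 - i)"
  proof (cases "i = N + 2")
    case False
    with i have "1 \<le> i" "i \<le> N + 1" by auto
    moreover from this have "rail w (N + 1 - i) \<le> N + 2 - i"
      using cover_vert_edge[OF w, of "N + 1 - i"] by linarith
    ultimately show ?thesis
      using cover_code_eq_rail[OF w, of i] by simp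
  qed simp
  then show "0 \<le> cover_code (N + 2) w i" "cover_code (N + 2) w i \<le> int (N + 2 - i)"
    by blast+
next
  fix i assume i: "1 \<le> i \<and> i < N + 2"
  show "if odd i then cover_code (N + 2) w (i + 1) < cover_code (N + 2) w i
    else cover_code (N + 2) w i \<le> cover_code (N + 2) w (i + 1)"
  \<comment> \<open>The last entry is set to zero by definition and has no rail formula, so this
    comparison is separate: the vanishing rail 0 fixes entry \<open>N + 1\<close>.\<close>
  proof (cases "i = N + 1")
    case True
    have "cover_code (N + 2) w (N + 1) = of_bool (even N)"
      using cover_code_eq_rail[OF w, of "N + 1"] w by simp
    with True show ?thesis by simp
  next
    case False
    define k where "k = N - i"
    have k: "N + 1 - i = k + 1" "N + 1 - (i + 1) = k" "N + 2 - i = k + 2"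
      "N + 2 - (i + 1) = k + 1" "k \<le> N"
      using i False by (auto simp: k_def)
    have "rail w k + rail w (k + 1) \<le> k + 1"
      using cover_vert_edge[OF w \<open>k \<le> N\<close>] by linarith
    moreover have "cover_code (N + 2) w i
        = (if even i then int (rail w (k + 1)) else int (k + 2) - int (rail w (k + 1)))"
      using cover_code_eq_rail[OF w, of i] i False unfolding k by linarith
    moreover have "cover_code (N + 2) w (i + 1)
        = (if even (i + 1) then int (rail w k) else int (k + 1) - int (rail w k))"
      using cover_code_eq_rail[OF w, of "i + 1"] i False unfolding k by linarith
    ultimately show ?thesis by simp
  qed
qed

lemma cover_code_inj:
  assumes w: "w \<in> grid_covers N" and w': "w' \<in> grid_covers N"
    and eq: "\<And>i. i \<in> {1..N + 2} \<Longrightarrow> cover_code (N + 2) w i = cover_code (N + 2) w' i"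
  shows "w = w'"
proof (rule cover_eqI[OF w w'])
  fix k assume k: "k \<in> {1..N}"
  then have i: "1 \<le> N + 1 - k" "N + 1 - k \<le> N + 1" "N + 1 - (N + 1 - k) = k"
    by auto
  then show "rail w k = rail w' k"
    using eq[of "N + 1 - k"] cover_code_eq_rail[OF w i(1,2)] cover_code_eq_rail[OF w' i(1,2)]
    by (simp split: if_splits)
qed

section \<open>From alternating codes back to covers\<close>

lemma alternating_codes_bounds:
  assumes "c \<in> alternating_codes n" "i \<in> {1..n}"
  shows "0 \<le> c i" "c i \<le> int (n - i)"
  using assms by (simp_all add: alternating_codes_def)

lemma alternating_codes_step:
  assumes "c \<in> alternating_codes n" "1 \<le> i" "i < n"
  shows "odd i \<Longrightarrow> c (i + 1) < c i" "even i \<Longrightarrow> c i \<le> c (i + 1)"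
proof -
  have "if odd i then c i > c (i + 1) else c i \<le> c (i + 1)"
    using assms unfolding alternating_codes_def by blast
  then show "odd i \<Longrightarrow> c (i + 1) < c i" "even i \<Longrightarrow> c i \<le> c (i + 1)"
    by simp_all
qed

lemma alternating_codes_last:
  assumes "c \<in> alternating_codes n" "1 \<le> n"
  shows "c n = 0"
  using alternating_codes_bounds[OF assms(1), of n] assms(2) by simp

text \<open>The bounds leave only 0 and 1, and the comparison with the last entry 0 decides by
  parity. This entry reflects the vanishing rail 0, so only the entries in \<open>{1..N}\<close> can
  vary.\<close>

lemma alternating_codes_penultimate:
  assumes "c \<in> alternating_codes (N + 2)"
  shows "c (N + 1) = of_bool (even N)"
  using alternating_codes_bounds[OF assms, of "N + 1"] alternating_codes_last[OF assms]
    alternating_codes_step[OF assms, of "N + 1"]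
  by (cases "even N") auto

text \<open>Solving \<open>cover_code_eq_rail\<close> for the rails gives a candidate sequence, and
  the alternating inequalities are exactly its admissibility.\<close>

lemma ex_cover_code:
  assumes c: "c \<in> alternating_codes (N + 2)"
  obtains w where "w \<in> grid_covers N" "\<And>i. i \<in> {1..N + 2} \<Longrightarrow> cover_code (N + 2) w i = c i"
proof -
  \<comment> \<open>The rail belonging to entry \<open>i = N + 1 - k\<close>. For
    \<open>k = N + 1\<close> this would be entry 0, about which nothing is known, so the required
    boundary value 0 is put in.\<close>
  define g where "g = (\<lambda>k. if k = N + 1 then 0
    else if even (N + 1 - k) then c (N + 1 - k) else int (k + 1) - c (N + 1 - k))"
  have g_nonneg: "0 \<le> g k" if "k \<le> N + 1" for k
  proof (cases "k = N + 1")
    case False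
    with that have "N + 1 - k \<in> {1..N + 2}" "N + 2 - (N + 1 - k) = k + 1" by auto
    then show ?thesis
      using alternating_codes_bounds[OF c, of "N + 1 - k"] by (simp add: g_def)
  qed (simp add: g_def)
  have g_0: "g 0 = 0"
    using alternating_codes_penultimate[OF c] by (simp add: g_def)
  have g_step: "g k + g (k + 1) \<le> int (k + 1)" if "k \<le> N" for k
  \<comment> \<open>Here the right neighbour is the boundary value, and the claim reduces to
    nonnegativity of entry 1.\<close>
  proof (cases "k = N")
    case True
    then show ?thesis
      using alternating_codes_bounds[OF c, of 1] by (simp add: g_def)
  next
    case False
    define i where "i = N - k"
    have i: "N + 1 - k = i + 1" "N + 1 - (k + 1) = i" "k \<noteq> N + 1" "k + 1 \<noteq> N + 1" "1 \<le> i" "i < N + 2"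
      using False that by (auto simp: i_def)
    show ?thesis
      using alternating_codes_step[OF c \<open>1 \<le> i\<close> \<open>i < N + 2\<close>] i(3,4)
      unfolding g_def i(1,2) by (cases "even i") auto
  qed
  obtain w where w: "w \<in> grid_covers N" and rail: "\<And>k. k \<le> N + 1 \<Longrightarrow> rail w k = nat (g k)"
  proof (rule ex_cover_rail[of "\<lambda>k. nat (g k)" N])
    show "nat (g k) + nat (g (k + 1)) \<le> k + 1" if "k \<le> N" for k
      using g_step[OF that] g_nonneg[of k] g_nonneg[of "k + 1"] that by linarith
  qed (simp_all add: g_0, simp add: g_def)
  have "cover_code (N + 2) w i = c i" if "i \<in> {1..N + 2}" for i
  proof (cases "i = N + 2")
    case True
    then show ?thesis using alternating_codes_last[OF c] by simp
  next
    case False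
    define k where "k = N + 1 - i"
    have k: "1 \<le> i" "i \<le> N + 1" "N + 1 - k = i" "k \<le> N" "N + 2 - i = k + 1"
      using False that by (auto simp: k_def)
    then have "int (rail w k) = (if even i then c i else int (k + 1) - c i)"
      using rail[of k] g_nonneg[of k] by (simp add: g_def)
    then show ?thesis
      using cover_code_eq_rail[OF w k(1,2), folded k_def] unfolding k(5)
      by (cases "even i") simp_all
  qed
  with w that show thesis by blast
qed

section \<open>Face twists\<close>

lemma black_iff: "black N v \<longleftrightarrow> (even (fst v + snd v) \<longleftrightarrow> odd N)"
  unfolding black_def by presburger

text \<open>The vertex \<open>(1, k)\<close> is black iff \<open>N - k\<close> is even, and the
  bottom edge is traversed towards it. Colours alternate around the square, so opposite edges are of
  the same kind.\<close>

lemma face_edges: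
  assumes "k \<in> {1..N}"
  shows "even (N - k) \<Longrightarrow> odd_edges N k = {horiz_edge 1 k, horiz_edge 2 k}"
    and "even (N - k) \<Longrightarrow> even_edges N k = {vert_edge (k - 1), vert_edge k}"
    and "odd (N - k) \<Longrightarrow> odd_edges N k = {vert_edge (k - 1), vert_edge k}"
    and "odd (N - k) \<Longrightarrow> even_edges N k = {horiz_edge 1 k, horiz_edge 2 k}"
proof -
  obtain m where m: "k = Suc m"
    using assms by (cases k) auto
  \<comment> \<open>The colour condition is abstracted to \<open>Q\<close>, so one description
    serves both odd and even edges.\<close>
  have boundary: "{{u, v} | u v. (u, v) \<in> face_boundary k \<and> Q u v} = {e.
      e = horiz_edge 1 k \<and> Q (1, k - 1) (1, k) \<or> e = vert_edge k \<and> Q (1, k) (2, k) \<or>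
      e = horiz_edge 2 k \<and> Q (2, k) (2, k - 1) \<or> e = vert_edge (k - 1) \<and> Q (2, k - 1) (1, k - 1)}" for Q
  proof -
    have edges: "horiz_edge 2 k = {(2, k), (2, k - 1)}" "vert_edge (k - 1) = {(2, k - 1), (1, k - 1)}"
      by (simp_all only: horiz_edge_def vert_edge_def insert_commute)
    have "{{u, v} | u v. (u, v) \<in> {(a, a'), (b, b'), (c, c'), (d, d')} \<and> Q u v} =
        {e. e = {a, a'} \<and> Q a a' \<or> e = {b, b'} \<and> Q b b' \<or> e = {c, c'} \<and> Q c c' \<or> e = {d, d'} \<and> Q d d'}"
      for a a' b b' c c' d d'
      unfolding insert_iff empty_iff prod.inject by (intro set_eqI iffI; elim CollectE exE conjE disjE; simp only: mem_Collect_eq; metis)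
    then show ?thesis
      unfolding edges unfolding horiz_edge_def vert_edge_def face_boundary_def .
  qed
  have "even (N - k) \<longleftrightarrow> (even N \<longleftrightarrow> even k)"
    using assms by simp
  moreover have "odd_edges N k = (if even N \<longleftrightarrow> even k then {horiz_edge 1 k, horiz_edge 2 k}
        else {vert_edge (k - 1), vert_edge k})"
    "even_edges N k = (if even N \<longleftrightarrow> even k then {vert_edge (k - 1), vert_edge k}
        else {horiz_edge 1 k, horiz_edge 2 k})"
    unfolding odd_edges_def even_edges_def boundary
    by (cases "even N"; cases "even k"; auto simp: black_iff m)+
  ultimately show "even (N - k) \<Longrightarrow> odd_edges N k = {horiz_edge 1 k, horiz_edge 2 k}"
    "even (N - k) \<Longrightarrow> even_edges N k = {vert_edge (k - 1), vert_edge k}"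
    "odd (N - k) \<Longrightarrow> odd_edges N k = {vert_edge (k - 1), vert_edge k}"
    "odd (N - k) \<Longrightarrow> even_edges N k = {horiz_edge 1 k, horiz_edge 2 k}"
    by simp_all
qed

lemma twist_at_horiz_edge:
  assumes "k \<in> {1..N}" "r \<in> {1, 2}"
  shows "twist_at N k w (horiz_edge r j) =
    (if j \<noteq> k then w (horiz_edge r j)
     else if even (N - k) then w (horiz_edge r j) - 1 else w (horiz_edge r j) + 1)"
  using assms(2) face_edges[OF assms(1)] by (cases "even (N - k)") (auto simp: twist_at_def)

lemma twist_at_vert_edge:
  assumes "k \<in> {1..N}"
  shows "twist_at N k w (vert_edge j) =
    (if j \<noteq> k - 1 \<and> j \<noteq> k then w (vert_edge j)
     else if even (N - k) then w (vert_edge j) + 1 else w (vert_edge j) - 1)"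
  using face_edges[OF assms] by (cases "even (N - k)") (auto simp: twist_at_def)

lemma twist_at_outside:
  assumes "k \<in> {1..N}" "e \<notin> grid_edges N"
  shows "twist_at N k w e = w e"
proof -
  have "horiz_edge 1 k \<in> grid_edges N" "horiz_edge 2 k \<in> grid_edges N"
    "vert_edge (k - 1) \<in> grid_edges N" "vert_edge k \<in> grid_edges N"
    using assms(1) by (auto simp: horiz_edge_mem_grid_edges vert_edge_mem_grid_edges)
  then have "e \<notin> odd_edges N k" "e \<notin> even_edges N k"
    using assms(2) face_edges[OF assms(1)] by (cases "even (N - k)"; auto)+
  then show ?thesis
    by (simp add: twist_at_def)
qed

text \<open>A twist of face \<open>k\<close> changes no other rail, since the remaining edges it
  touches are vertical. Conversely, the vertex equations turn such a change of one rail into the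
  full twist.\<close>

lemma positive_twist_iff_rail:
  "(w, w') \<in> positive_twist N \<longleftrightarrow> w \<in> grid_covers N \<and> w' \<in> grid_covers N \<and>
     (\<exists>k\<in>{1..N}. (\<forall>j. j \<noteq> k \<longrightarrow> rail w' j = rail w j) \<and>
        (if even (N - k) then rail w k = rail w' k + 1 else rail w' k = rail w k + 1))"
    (is "_ \<longleftrightarrow> _ \<and> _ \<and> (\<exists>k\<in>{1..N}. ?R k)")
proof -
  have "(\<forall>e\<in>odd_edges N k. w e > 0) \<and> w' = twist_at N k w \<longleftrightarrow> ?R k"
    if w: "w \<in> grid_covers N" and w': "w' \<in> grid_covers N" and k: "k \<in> {1..N}" for k
  proof
    assume twist: "(\<forall>e\<in>odd_edges N k. w e > 0) \<and> w' = twist_at N k w"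
    then have "rail w' j = (if j \<noteq> k then rail w j
        else if even (N - k) then rail w j - 1 else rail w j + 1)" for j
      using twist_at_horiz_edge[OF k, of 1] by (simp add: rail_def)
    moreover have "rail w k > 0" if "even (N - k)"
      using face_edges(1)[OF k that] twist by (simp add: rail_def)
    ultimately show "?R k"
      by auto
  next
    assume R: "?R k"
    have vert: "w (vert_edge j) + rail w j + rail w (j + 1)
        = w' (vert_edge j) + rail w' j + rail w' (j + 1)" if "j \<le> N" for j
      using cover_vert_edge[OF w that] cover_vert_edge[OF w' that] by simp
    obtain m where m: "k = m + 1" "m \<le> N"
      using k by (cases k) auto
    \<comment> \<open>If the vertical edges are odd, the rise of rail \<open>k\<close> takes one
      unit from each of them, and what remains in \<open>w'\<close> is a natural number; hence they
      were positive.\<close>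
    have pos: "\<forall>e\<in>odd_edges N k. w e > 0"
    proof (cases "even (N - k)")
      case True
      then show ?thesis
        using R cover_horiz_edge[OF w, of 1 k] cover_horiz_edge[OF w, of 2 k] face_edges(1)[OF k]
        by simp
    next
      case False
      then show ?thesis
        using R vert[of k] vert[of m] m k face_edges(3)[OF k] by simp
    qed
    have "w' e = twist_at N k w e" for e
    proof (cases "e \<in> grid_edges N")
      case True
      then show ?thesis
      proof (cases rule: grid_edges_cases)
        case (vert j)
        have "rail w' j = (if j \<noteq> k then rail w j
            else if even (N - k) then rail w j - 1 else rail w j + 1)"
          "rail w' (j + 1) = (if j \<noteq> m then rail w (j + 1)
            else if even (N - k) then rail w (j + 1) - 1 else rail w (j + 1) + 1)"
          "even (N - k) \<Longrightarrow> rail w k > 0"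
          using R m by auto
        then show ?thesis
          using \<open>\<And>j. j \<le> N \<Longrightarrow> w (vert_edge j) + _ + _ = _\<close>[OF vert(1)]
          unfolding vert(2) twist_at_vert_edge[OF k] by (auto simp: m split: if_splits)
      next
        case (horiz r j)
        then show ?thesis
          using R cover_horiz_edge[OF w horiz(1)] cover_horiz_edge[OF w' horiz(1)]
          unfolding horiz(3) twist_at_horiz_edge[OF k horiz(1)] by (auto split: if_splits)
      qed
    next
      case False
      then show ?thesis
        using w w' by (simp add: twist_at_outside[OF k] grid_covers_iff)
    qed
    with pos show "(\<forall>e\<in>odd_edges N k. w e > 0) \<and> w' = twist_at N k w"
      by blast
  qed
  then have "w \<in> grid_covers N \<Longrightarrow> w' \<in> grid_covers N \<Longrightarrow>
      (\<exists>k\<in>{1..N}. (\<forall>e\<in>odd_edges N k. w e > 0) \<and> w' = twist_at N k w) \<longleftrightarrow> (\<exists>k\<in>{1..N}. ?R k)"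
    by (intro bex_cong refl)
  then show ?thesis
    unfolding positive_twist_def mem_Collect_eq prod.case by blast
qed

text \<open>With \<open>i = N + 1 - k\<close>, rail \<open>k\<close> enters entry \<open>i\<close>
  negatively for odd \<open>i\<close>, where the twist lowers it, and positively for even
  \<open>i\<close>, where the twist raises it. The entry grows by one in both cases.\<close>

lemma positive_twist_iff_code:
  "(w, w') \<in> positive_twist N \<longleftrightarrow> w \<in> grid_covers N \<and> w' \<in> grid_covers N \<and>
     (\<exists>i\<in>{1..N}. \<forall>j\<in>{1..N + 2}.
        cover_code (N + 2) w' j = cover_code (N + 2) w j + of_bool (j = i))"
proof (cases "w \<in> grid_covers N \<and> w' \<in> grid_covers N")
  case True
  then have w: "w \<in> grid_covers N" and w': "w' \<in> grid_covers N"
    by auto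
  have "(\<forall>j. j \<noteq> k \<longrightarrow> rail w' j = rail w j) \<and>
        (if even (N - k) then rail w k = rail w' k + 1 else rail w' k = rail w k + 1) \<longleftrightarrow>
      (\<forall>j\<in>{1..N + 2}. cover_code (N + 2) w' j = cover_code (N + 2) w j + of_bool (j = i))"
    (is "?R \<longleftrightarrow> ?C") if k: "k \<in> {1..N}" and i: "i = N + 1 - k" for i k
  proof
    assume R: ?R
    show ?C
    proof
      fix j assume j: "j \<in> {1..N + 2}"
      show "cover_code (N + 2) w' j = cover_code (N + 2) w j + of_bool (j = i)"
      proof (cases "j = N + 2")
        case True
        with k i show ?thesis by simp
      next
        case False
        with j have j': "1 \<le> j" "j \<le> N + 1" by auto
        have "even (N - k) \<longleftrightarrow> odd i" "j = i \<longleftrightarrow> N + 1 - j = k"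
          using k i j' by auto
        with R show ?thesis
          unfolding cover_code_eq_rail[OF w j'] cover_code_eq_rail[OF w' j']
          by (cases "j = i") (auto split: if_splits)
      qed
    qed
  next
    assume C: ?C
    have *: "if even (N - l) then rail w l = rail w' l + of_bool (l = k)
        else rail w' l = rail w l + of_bool (l = k)" if "l \<in> {1..N}" for l
    proof -
      define j where "j = N + 1 - l"
      have j: "1 \<le> j" "j \<le> N + 1" "N + 1 - j = l" "even (N - l) \<longleftrightarrow> odd j" "j = i \<longleftrightarrow> l = k"
        using that k i by (auto simp: j_def)
      have "cover_code (N + 2) w' j = cover_code (N + 2) w j + of_bool (l = k)"
        using C j by simp
      then show ?thesis
        unfolding cover_code_eq_rail[OF w j(1,2)] cover_code_eq_rail[OF w' j(1,2)] j(3,4)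
        by (cases "odd j"; cases "l = k") auto
    qed
    have "rail w' l = rail w l" if "l \<noteq> k" for l
    proof (cases "l \<in> {1..N}")
      case True
      with *[OF True] that show ?thesis by (simp split: if_splits)
    next
      case False
      then show ?thesis using w w' by (auto simp: not_le)
    qed
    with *[OF k] show ?R by simp
  qed
  then have "(\<exists>k\<in>{1..N}. (\<forall>j. j \<noteq> k \<longrightarrow> rail w' j = rail w j) \<and>
        (if even (N - k) then rail w k = rail w' k + 1 else rail w' k = rail w k + 1)) \<longleftrightarrow>
      (\<exists>k\<in>{1..N}. \<forall>j\<in>{1..N + 2}.
        cover_code (N + 2) w' j = cover_code (N + 2) w j + of_bool (j = N + 1 - k))"
    by blast
  also have "\<dots> \<longleftrightarrow> (\<exists>i\<in>(\<lambda>k. N + 1 - k) ` {1..N}. \<forall>j\<in>{1..N + 2}.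
        cover_code (N + 2) w' j = cover_code (N + 2) w j + of_bool (j = i))"
    by blast
  also have "(\<lambda>k. N + 1 - k) ` {1..N} = {1..N}"
    by (rule bij_betw_imp_surj_on, rule bij_betw_byWitness[of _ "\<lambda>k. N + 1 - k"]) auto
  finally show ?thesis
    unfolding positive_twist_iff_rail by blast
qed (auto simp: positive_twist_def)

section \<open>The twist order and the rank\<close>

text \<open>Odd-indexed entries exceed their neighbours, so they can be raised freely; once none of
  them is below its target, an even-indexed one can be raised.\<close>

lemma alternating_codes_raise:
  assumes c: "c \<in> alternating_codes (N + 2)" and d: "d \<in> alternating_codes (N + 2)"
    and le: "\<And>i. i \<in> {1..N + 2} \<Longrightarrow> c i \<le> d i"
    and neq: "\<exists>i\<in>{1..N + 2}. c i \<noteq> d i"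
  obtains i where "i \<in> {1..N}" "c i < d i"
    "(\<lambda>j. c j + of_bool (j = i)) \<in> alternating_codes (N + 2)"
proof -
  \<comment> \<open>The last two entries are the same in all alternating codes.\<close>
  have in_range: "i \<in> {1..N}" if "i \<in> {1..N + 2}" "c i \<noteq> d i" for i
  proof -
    have "i \<noteq> N + 2" "i \<noteq> N + 1"
      using that(2) alternating_codes_last[OF c] alternating_codes_last[OF d]
        alternating_codes_penultimate[OF c] alternating_codes_penultimate[OF d] by auto
    with that(1) show ?thesis by auto
  qed
  \<comment> \<open>For even \<open>i\<close> the neighbours already have their values from
    \<open>d\<close>. As the raised entry is still at most \<open>d i\<close>, the inequalities of
    \<open>d\<close> leave room for it.\<close>
  have raise: "(\<lambda>j. c j + of_bool (j = i)) \<in> alternating_codes (N + 2)"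
    if i: "i \<in> {1..N}" "c i < d i"
      and even: "even i \<Longrightarrow> c (i + 1) = d (i + 1) \<and> (i \<noteq> 1 \<longrightarrow> c (i - 1) = d (i - 1))" for i
    unfolding alternating_codes_def mem_Collect_eq
  proof (intro conjI ballI allI impI)
    fix j assume j: "j \<in> {1..N + 2}"
    show "0 \<le> c j + of_bool (j = i)"
      using alternating_codes_bounds[OF c j] by simp
    show "c j + of_bool (j = i) \<le> int (N + 2 - j)"
      using alternating_codes_bounds[OF c j] alternating_codes_bounds[OF d j] i(2) by auto
  next
    fix j assume j: "1 \<le> j \<and> j < N + 2"
    then have step: "odd j \<Longrightarrow> c (j + 1) < c j" "even j \<Longrightarrow> c j \<le> c (j + 1)"
      "odd j \<Longrightarrow> d (j + 1) < d j" "even j \<Longrightarrow> d j \<le> d (j + 1)"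
      using alternating_codes_step[OF c] alternating_codes_step[OF d] by blast+
    show "if odd j then c (j + 1) + of_bool (j + 1 = i) < c j + of_bool (j = i)
      else c j + of_bool (j = i) \<le> c (j + 1) + of_bool (j + 1 = i)"
    proof (cases "odd j")
      case True
      with step(1,3) even i(2) j show ?thesis
        by (cases "j + 1 = i") auto
    next
      case False
      with step(2,4) even i(2) j show ?thesis
        by (cases "j = i") auto
    qed
  qed
  show thesis
  proof (cases "\<exists>i\<in>{1..N + 2}. odd i \<and> c i \<noteq> d i")
    case True
    then obtain i where i: "i \<in> {1..N + 2}" "odd i" "c i \<noteq> d i" by blast
    then have "c i < d i" using le[of i] by simp
    then show thesis
      using that[of i] raise[of i] in_range i by blast
  next
    case False
    obtain i where i: "i \<in> {1..N + 2}" "c i \<noteq> d i" using neq by blast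
    then have i': "i \<in> {1..N}" "c i < d i"
      using in_range[of i] le[of i] by auto
    moreover have "c (i + 1) = d (i + 1) \<and> (i \<noteq> 1 \<longrightarrow> c (i - 1) = d (i - 1))" if "even i"
    proof -
      have "i + 1 \<in> {1..N + 2}" "odd (i + 1)" "i - 1 \<in> {1..N + 2}" "odd (i - 1)"
        using i'(1) that by (auto elim!: evenE)
      with False show ?thesis by blast
    qed
    ultimately show thesis
      using that[of i] raise[of i] by blast
  qed
qed

text \<open>Each twist adds one to a single entry. In particular the code sums fix the number of
  twists between two covers, whichever faces are chosen.\<close>

lemma relpow_positive_twist_code:
  assumes "(w, w') \<in> positive_twist N ^^ m" "w \<in> grid_covers N"
  shows "w' \<in> grid_covers N"
    and "\<forall>i\<in>{1..N + 2}. cover_code (N + 2) w i \<le> cover_code (N + 2) w' i"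
    and "(\<Sum>i\<in>{1..N + 2}. cover_code (N + 2) w' i) = (\<Sum>i\<in>{1..N + 2}. cover_code (N + 2) w i) + int m"
proof -
  have "w' \<in> grid_covers N \<and>
      (\<forall>i\<in>{1..N + 2}. cover_code (N + 2) w i \<le> cover_code (N + 2) w' i) \<and>
      (\<Sum>i\<in>{1..N + 2}. cover_code (N + 2) w' i)
        = (\<Sum>i\<in>{1..N + 2}. cover_code (N + 2) w i) + int m"
    using assms(1)
  proof (induction m arbitrary: w')
    case 0
    with assms(2) show ?case by simp
  next
    case (Suc m)
    obtain v where v: "(w, v) \<in> positive_twist N ^^ m" "(v, w') \<in> positive_twist N"
      using Suc.prems by (rule relpow_Suc_E)
    then obtain i where i: "w' \<in> grid_covers N" "i \<in> {1..N}"
      "\<forall>j\<in>{1..N + 2}. cover_code (N + 2) w' j = cover_code (N + 2) v j + of_bool (j = i)"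
      unfolding positive_twist_iff_code by blast
    have "(\<Sum>j\<in>{1..N + 2}. cover_code (N + 2) w' j)
        = (\<Sum>j\<in>{1..N + 2}. cover_code (N + 2) v j + of_bool (j = i))"
      using i(3) by (intro sum.cong refl) blast
    also have "\<dots> = (\<Sum>j\<in>{1..N + 2}. cover_code (N + 2) v j) + 1"
      using i(2) by (simp add: sum.distrib of_bool_def del: sum.cl_ivl_Suc)
    finally have "(\<Sum>j\<in>{1..N + 2}. cover_code (N + 2) w' j)
        = (\<Sum>i\<in>{1..N + 2}. cover_code (N + 2) w i) + int (Suc m)"
      using Suc.IH[OF v(1)] by linarith
    moreover have "cover_code (N + 2) w j \<le> cover_code (N + 2) w' j" if "j \<in> {1..N + 2}" for j
    proof -
      have "cover_code (N + 2) w j \<le> cover_code (N + 2) v j"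
        using Suc.IH[OF v(1)] that by blast
      also have "\<dots> \<le> cover_code (N + 2) w' j"
        using i(3) that by simp
      finally show ?thesis .
    qed
    ultimately show ?case
      using i(1) by blast
  qed
  then show "w' \<in> grid_covers N"
    "\<forall>i\<in>{1..N + 2}. cover_code (N + 2) w i \<le> cover_code (N + 2) w' i"
    "(\<Sum>i\<in>{1..N + 2}. cover_code (N + 2) w' i) = (\<Sum>i\<in>{1..N + 2}. cover_code (N + 2) w i) + int m"
    by blast+
qed

text \<open>Induction on the total gap between the codes: \<open>alternating_codes_raise\<close>
  gives a unit step towards the target, and \<open>ex_cover_code\<close> realises the raised code by
  a cover one twist away.\<close>

lemma ex_relpow_positive_twist:
  assumes "w \<in> grid_covers N" and w': "w' \<in> grid_covers N"
    and "\<forall>i\<in>{1..N + 2}. cover_code (N + 2) w i \<le> cover_code (N + 2) w' i"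
  shows "\<exists>m. (w, w') \<in> positive_twist N ^^ m"
  using assms(1,3)
proof (induction "nat (\<Sum>i\<in>{1..N + 2}. cover_code (N + 2) w' i - cover_code (N + 2) w i)"
    arbitrary: w rule: less_induct)
  case (less w)
  show ?case
  proof (cases "\<exists>i\<in>{1..N + 2}. cover_code (N + 2) w i \<noteq> cover_code (N + 2) w' i")
    case False
    then have "w = w'"
      using cover_code_inj[OF less.prems(1) w'] by blast
    then have "(w, w') \<in> positive_twist N ^^ 0" by simp
    then show ?thesis ..
  next
    case True
    obtain i where i: "i \<in> {1..N}" "cover_code (N + 2) w i < cover_code (N + 2) w' i"
      "(\<lambda>j. cover_code (N + 2) w j + of_bool (j = i)) \<in> alternating_codes (N + 2)"
      by (rule alternating_codes_raise[OF cover_code_mem[OF less.prems(1)] cover_code_mem[OF w'] _ True])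
        (use less.prems(2) in blast)+
    obtain v where v: "v \<in> grid_covers N"
      "\<And>j. j \<in> {1..N + 2} \<Longrightarrow> cover_code (N + 2) v j = cover_code (N + 2) w j + of_bool (j = i)"
      by (rule ex_cover_code[OF i(3)]) blast
    have step: "(w, v) \<in> positive_twist N"
      unfolding positive_twist_iff_code using less.prems(1) v i(1) by blast
    have le: "cover_code (N + 2) v j \<le> cover_code (N + 2) w' j" if "j \<in> {1..N + 2}" for j
      using v(2)[OF that] less.prems(2) i(2) that by (cases "j = i") auto
    have "(\<Sum>j\<in>{1..N + 2}. cover_code (N + 2) w' j - cover_code (N + 2) v j)
        < (\<Sum>j\<in>{1..N + 2}. cover_code (N + 2) w' j - cover_code (N + 2) w j)"
    proof (rule sum_strict_mono_ex1)
      show "\<forall>j\<in>{1..N + 2}. cover_code (N + 2) w' j - cover_code (N + 2) v j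
          \<le> cover_code (N + 2) w' j - cover_code (N + 2) w j"
        using v(2) by simp
      show "\<exists>j\<in>{1..N + 2}. cover_code (N + 2) w' j - cover_code (N + 2) v j
          < cover_code (N + 2) w' j - cover_code (N + 2) w j"
        using v(2)[of i] i(1) by (intro bexI[of _ i]) auto
    qed simp
    \<comment> \<open>Nonnegativity carries the strict decrease through \<open>nat\<close>.\<close>
    moreover have "0 \<le> (\<Sum>j\<in>{1..N + 2}. cover_code (N + 2) w' j - cover_code (N + 2) v j)"
      using le by (intro sum_nonneg) simp
    ultimately have "nat (\<Sum>j\<in>{1..N + 2}. cover_code (N + 2) w' j - cover_code (N + 2) v j)
        < nat (\<Sum>j\<in>{1..N + 2}. cover_code (N + 2) w' j - cover_code (N + 2) w j)"
      by linarith
    then obtain m where "(v, w') \<in> positive_twist N ^^ m"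
      using less.hyps[OF _ v(1)] le by blast
    with step have "(w, w') \<in> positive_twist N ^^ Suc m"
      by (rule relpow_Suc_I2)
    then show ?thesis ..
  qed
qed

lemma twist_order_iff:
  "(w, w') \<in> twist_order N \<longleftrightarrow> w \<in> grid_covers N \<and> w' \<in> grid_covers N \<and>
     (\<forall>i\<in>{1..N + 2}. cover_code (N + 2) w i \<le> cover_code (N + 2) w' i)"
  unfolding twist_order_def Int_iff mem_Sigma_iff rtrancl_power
  using relpow_positive_twist_code(2)[of w w' _ N] ex_relpow_positive_twist[of w N w'] by blast

text \<open>The Lehmer code of 2 1 4 3 ...; for odd \<open>n\<close> the last position has no
  partner, hence the condition \<open>i < n\<close>.\<close>

definition min_code :: "nat \<Rightarrow> nat \<Rightarrow> int" where
  "min_code n i = of_bool (odd i \<and> i < n)"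

lemma min_code_mem: "min_code n \<in> alternating_codes n"
  unfolding alternating_codes_def min_code_def by auto

text \<open>An entry at an odd position before the last strictly exceeds a nonnegative neighbour, so
  it is at least 1.\<close>

lemma min_code_le:
  assumes "c \<in> alternating_codes n" "i \<in> {1..n}"
  shows "min_code n i \<le> c i"
proof (cases "odd i \<and> i < n")
  case True
  then have "i + 1 \<in> {1..n}" "c (i + 1) < c i"
    using alternating_codes_step(1)[OF assms(1)] assms(2) by auto
  with alternating_codes_bounds[OF assms(1)] True show ?thesis
    by (fastforce simp: min_code_def)
next
  case False
  with alternating_codes_bounds[OF assms] show ?thesis
    by (auto simp: min_code_def)
qed

text \<open>This number of odd positions below \<open>n\<close> becomes the exponent of the
  prefactor in the generating function identity.\<close>

lemma sum_min_code: "(\<Sum>i\<in>{1..n}. min_code n i) = int (n div 2)"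
proof -
  have "(\<Sum>i\<in>{1..n}. min_code n i) = (\<Sum>i<n. of_bool (odd i))"
    by (rule sum.mono_neutral_cong) (auto simp: min_code_def Suc_le_eq odd_pos)
  also have "\<dots> = int (n div 2)"
    by (induction n) auto
  finally show ?thesis .
qed

text \<open>The cover \<open>w\<close> with code \<open>min_code\<close> lies below every cover. It
  is therefore minimal, and any other minimal cover must coincide with it, which resolves the
  \<open>THE\<close>.\<close>

lemma minimal_cover:
  shows minimal_cover_mem: "minimal_cover N \<in> grid_covers N"
    and minimal_cover_code: "i \<in> {1..N + 2} \<Longrightarrow> cover_code (N + 2) (minimal_cover N) i = min_code (N + 2) i"
proof -
  obtain w where w: "w \<in> grid_covers N"
    "\<And>i. i \<in> {1..N + 2} \<Longrightarrow> cover_code (N + 2) w i = min_code (N + 2) i"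
    by (rule ex_cover_code[OF min_code_mem[of "N + 2"]]) blast
  have least: "(w, w') \<in> twist_order N" if "w' \<in> grid_covers N" for w'
    unfolding twist_order_iff using w that min_code_le[OF cover_code_mem[OF that]] by simp
  have "minimal_cover N = w"
    unfolding minimal_cover_def
  proof (rule the_equality)
    show "w \<in> grid_covers N \<and> (\<forall>w'\<in>grid_covers N. (w', w) \<in> twist_order N \<longrightarrow> w' = w)"
    proof (intro conjI ballI impI)
      fix w' assume w': "w' \<in> grid_covers N" "(w', w) \<in> twist_order N"
      show "w' = w"
      proof (rule cover_code_inj[OF w'(1) w(1)])
        fix i assume "i \<in> {1..N + 2}"
        with least[OF w'(1)] w'(2) show "cover_code (N + 2) w' i = cover_code (N + 2) w i"
          unfolding twist_order_iff by (meson order_antisym)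
      qed
    qed (fact w(1))
  qed (use least w(1) in blast)
  with w show "minimal_cover N \<in> grid_covers N"
    "i \<in> {1..N + 2} \<Longrightarrow> cover_code (N + 2) (minimal_cover N) i = min_code (N + 2) i"
    by simp_all
qed

text \<open>The minimal cover lies below \<open>w\<close>, so the \<open>LEAST\<close> is attained,
  and the growth of the code sum counts the twists.\<close>

lemma cover_rank_code:
  assumes w: "w \<in> grid_covers N"
  shows "(\<Sum>i\<in>{1..N + 2}. cover_code (N + 2) w i) = int ((N + 2) div 2 + cover_rank N w)"
proof -
  have "\<forall>i\<in>{1..N + 2}. cover_code (N + 2) (minimal_cover N) i \<le> cover_code (N + 2) w i"
    using minimal_cover_code min_code_le[OF cover_code_mem[OF w]] by metis
  then have "\<exists>m. (minimal_cover N, w) \<in> positive_twist N ^^ m"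
    by (rule ex_relpow_positive_twist[OF minimal_cover_mem w])
  then have "(minimal_cover N, w) \<in> positive_twist N ^^ cover_rank N w"
    unfolding cover_rank_def by (rule LeastI_ex)
  then have "(\<Sum>i\<in>{1..N + 2}. cover_code (N + 2) w i)
      = (\<Sum>i\<in>{1..N + 2}. cover_code (N + 2) (minimal_cover N) i) + int (cover_rank N w)"
    by (rule relpow_positive_twist_code(3)[OF _ minimal_cover_mem])
  also have "(\<Sum>i\<in>{1..N + 2}. cover_code (N + 2) (minimal_cover N) i) = (\<Sum>i\<in>{1..N + 2}. min_code (N + 2) i)"
    by (intro sum.cong refl minimal_cover_code)
  finally show ?thesis
    using sum_min_code[of "N + 2"] by simp
qed

section \<open>The isomorphism\<close>

text \<open>Cover codes satisfy the Lehmer bounds, so \<open>ex1_lehmer\<close> applies once the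
  entries are moved from integers to naturals.\<close>

lemma phi_spec:
  assumes w: "w \<in> grid_covers N"
  shows "phi (N + 2) w \<in> symgroup (N + 2)"
    and "i \<in> {1..N + 2} \<Longrightarrow> int (lehmer (N + 2) (phi (N + 2) w) i) = cover_code (N + 2) w i"
proof -
  note bounds = alternating_codes_bounds[OF cover_code_mem[OF w]]
  have iff: "int a = cover_code (N + 2) w i \<longleftrightarrow> a = nat (cover_code (N + 2) w i)"
    if "i \<in> {1..N + 2}" for a i
    using bounds[OF that] by linarith
  have "\<exists>!\<sigma>. \<sigma> \<in> symgroup (N + 2) \<and>
      (\<forall>i\<in>{1..N + 2}. lehmer (N + 2) \<sigma> i = nat (cover_code (N + 2) w i))"
    by (rule ex1_lehmer) (use bounds in \<open>simp only: nat_le_iff\<close>)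
  then have "\<exists>!\<sigma>. \<sigma> \<in> symgroup (N + 2) \<and>
      (\<forall>i\<in>{1..N + 2}. int (lehmer (N + 2) \<sigma> i) = cover_code (N + 2) w i)"
    by (simp only: iff cong: ball_cong)
  from theI'[OF this] show "phi (N + 2) w \<in> symgroup (N + 2)"
    "i \<in> {1..N + 2} \<Longrightarrow> int (lehmer (N + 2) (phi (N + 2) w) i) = cover_code (N + 2) w i"
    unfolding phi_def by blast+
qed

lemma phi_mem_alternating_perms:
  assumes "w \<in> grid_covers N"
  shows "phi (N + 2) w \<in> alternating_perms (N + 2)"
  unfolding alternating_perms_iff_code
proof (rule conjI)
  show "phi (N + 2) w \<in> symgroup (N + 2)"
    by (rule phi_spec(1)[OF assms])
  show "(\<lambda>i. int (lehmer (N + 2) (phi (N + 2) w) i)) \<in> alternating_codes (N + 2)"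
    using cover_code_mem[OF assms] phi_spec(2)[OF assms] by (rule alternating_codes_transfer)
qed

text \<open>Both sides are parametrised by alternating codes: covers through
  \<open>cover_code\<close>, permutations through \<open>lehmer\<close>, and \<open>phi\<close>
  matches equal codes.\<close>

lemma bij_betw_phi: "bij_betw (phi (N + 2)) (grid_covers N) (alternating_perms (N + 2))"
  unfolding bij_betw_def
proof (intro conjI equalityI subsetI inj_onI)
  fix w w' assume w: "w \<in> grid_covers N" "w' \<in> grid_covers N" "phi (N + 2) w = phi (N + 2) w'"
  show "w = w'"
    by (rule cover_code_inj[OF w(1,2)]) (metis phi_spec(2) w)
next
  fix \<sigma> assume "\<sigma> \<in> alternating_perms (N + 2)"
  then have \<sigma>: "\<sigma> \<in> symgroup (N + 2)"
    "(\<lambda>i. int (lehmer (N + 2) \<sigma> i)) \<in> alternating_codes (N + 2)"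
    unfolding alternating_perms_iff_code by blast+
  obtain w where w: "w \<in> grid_covers N"
    "\<And>i. i \<in> {1..N + 2} \<Longrightarrow> cover_code (N + 2) w i = int (lehmer (N + 2) \<sigma> i)"
    by (rule ex_cover_code[OF \<sigma>(2)]) blast
  have "phi (N + 2) w = \<sigma>"
    by (rule lehmer_inj[OF phi_spec(1)[OF w(1)] \<sigma>(1)]) (metis phi_spec(2) w of_nat_eq_iff)
  with w(1) show "\<sigma> \<in> phi (N + 2) ` grid_covers N"
    by blast
next
  fix \<sigma> assume "\<sigma> \<in> phi (N + 2) ` grid_covers N"
  then show "\<sigma> \<in> alternating_perms (N + 2)"
    using phi_mem_alternating_perms by (elim imageE) simp
qed

lemma twist_order_iff_phi:
  assumes "w \<in> grid_covers N" "w' \<in> grid_covers N"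
  shows "(w, w') \<in> twist_order N \<longleftrightarrow> (phi (N + 2) w, phi (N + 2) w') \<in>
    left_middle_order (N + 2) \<inter> alternating_perms (N + 2) \<times> alternating_perms (N + 2)"
proof -
  have "lehmer (N + 2) (phi (N + 2) w) i \<le> lehmer (N + 2) (phi (N + 2) w') i \<longleftrightarrow>
      cover_code (N + 2) w i \<le> cover_code (N + 2) w' i" if "i \<in> {1..N + 2}" for i
    using phi_spec(2)[OF assms(1) that] phi_spec(2)[OF assms(2) that] by linarith
  moreover have "(phi (N + 2) w, phi (N + 2) w') \<in>
      left_middle_order (N + 2) \<inter> alternating_perms (N + 2) \<times> alternating_perms (N + 2) \<longleftrightarrow>
      (\<forall>i\<in>{1..N + 2}. lehmer (N + 2) (phi (N + 2) w) i \<le> lehmer (N + 2) (phi (N + 2) w') i)"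
    unfolding left_middle_order_def Int_iff mem_Sigma_iff mem_Collect_eq prod.case
    using assms by (simp only: phi_spec(1) phi_mem_alternating_perms simp_thms)
  ultimately show ?thesis
    unfolding twist_order_iff using assms by (simp only: simp_thms cong: ball_cong)
qed

lemma partial_order_on_twist_order: "partial_order_on (grid_covers N) (twist_order N)"
  unfolding partial_order_on_def preorder_on_def
proof (intro conjI)
  \<comment> \<open>Two covers below each other have equal codes, and the code determines the
    cover.\<close>
  show "antisym (twist_order N)"
  proof (rule antisymI)
    fix w w' assume "(w, w') \<in> twist_order N" "(w', w) \<in> twist_order N"
    then have *: "w \<in> grid_covers N" "w' \<in> grid_covers N"
      "\<forall>i\<in>{1..N + 2}. cover_code (N + 2) w i \<le> cover_code (N + 2) w' i"
      "\<forall>i\<in>{1..N + 2}. cover_code (N + 2) w' i \<le> cover_code (N + 2) w i"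
      unfolding twist_order_iff by blast+
    show "w = w'"
      by (rule cover_code_inj[OF *(1,2)], rule order_antisym) (use *(3,4) in blast)+
  qed
  show "trans (twist_order N)"
    unfolding twist_order_def by (intro trans_Restr trans_rtrancl)
qed (simp_all add: refl_on_def twist_order_def subset_iff)

lemma partial_order_on_left_middle_order:
  assumes "A \<subseteq> symgroup n"
  shows "partial_order_on A (left_middle_order n \<inter> A \<times> A)"
  unfolding partial_order_on_def preorder_on_def
proof (intro conjI)
  show "antisym (left_middle_order n \<inter> A \<times> A)"
  proof (rule antisymI)
    fix \<sigma> \<tau>
    assume "(\<sigma>, \<tau>) \<in> left_middle_order n \<inter> A \<times> A" "(\<tau>, \<sigma>) \<in> left_middle_order n \<inter> A \<times> A"
    then have "\<sigma> \<in> symgroup n" "\<tau> \<in> symgroup n" "\<forall>i\<in>{1..n}. lehmer n \<sigma> i = lehmer n \<tau> i"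
      by (auto simp: left_middle_order_def intro: order_antisym)
    then show "\<sigma> = \<tau>"
      by (blast intro: lehmer_inj)
  qed
  show "trans (left_middle_order n \<inter> A \<times> A)"
    by (rule transI) (auto simp: left_middle_order_def intro: order_trans)
qed (use assms in \<open>auto simp: refl_on_def left_middle_order_def\<close>)

text \<open>Inversions are the sum of the Lehmer code, which is the code sum of the cover and hence
  known from its rank.\<close>

lemma inv_count_phi:
  assumes "w \<in> grid_covers N"
  shows "inv_count (N + 2) (phi (N + 2) w) = (N + 2) div 2 + cover_rank N w"
proof -
  have "int (inv_count (N + 2) (phi (N + 2) w)) = (\<Sum>i\<in>{1..N + 2}. cover_code (N + 2) w i)"
    unfolding inv_count_eq_sum_lehmer of_nat_sum
    by (intro sum.cong refl phi_spec(2)[OF assms])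
  then show ?thesis
    unfolding cover_rank_code[OF assms] by (simp only: of_nat_eq_iff)
qed

theorem theorem9:
  fixes n :: nat and q :: "'a::comm_semiring_1"
  assumes "n \<ge> 2"
  shows "(\<forall>w\<in>grid_covers (n - 2). phi n w \<in> symgroup n \<and>
            (\<forall>i\<in>{1..n}. int (lehmer n (phi n w) i) = cover_code n w i)) \<and>
         poset_isomorphism (grid_covers (n - 2)) (twist_order (n - 2))
           (alternating_perms n)
           (left_middle_order n \<inter> alternating_perms n \<times> alternating_perms n)
           (phi n) \<and>
         alternating_gf n q = q ^ (n div 2) * cover_gf (n - 2) q"
proof -
  define N where "N = n - 2"
  have n: "n = N + 2"
    using assms by (simp add: N_def)
  have "poset_isomorphism (grid_covers N) (twist_order N) (alternating_perms n)
      (left_middle_order n \<inter> alternating_perms n \<times> alternating_perms n) (phi n)"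
    unfolding poset_isomorphism_def n
    using partial_order_on_twist_order bij_betw_phi twist_order_iff_phi
      partial_order_on_left_middle_order[of "alternating_perms (N + 2)" "N + 2"]
    by (auto simp only: alternating_perms_def)
  moreover have "alternating_gf n q = q ^ (n div 2) * cover_gf N q"
  proof -
    have "alternating_gf n q = (\<Sum>w\<in>grid_covers N. q ^ inv_count n (phi n w))"
      unfolding alternating_gf_def n
      by (rule sum.reindex_bij_betw[OF bij_betw_phi, symmetric])
    also have "\<dots> = (\<Sum>w\<in>grid_covers N. q ^ (n div 2) * q ^ cover_rank N w)"
      unfolding n by (intro sum.cong refl) (simp only: inv_count_phi power_add)
    finally show ?thesis
      by (simp only: cover_gf_def sum_distrib_left)
  qed
  ultimately show ?thesis
    using phi_spec[of _ N] unfolding n add_diff_cancel_right' by blast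
qed

end
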